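(* Let $d\geq 2$ be an integer and let $S:\mathbb{R}^d\to\mathbb{R}^d$ be the quasiregular mapping described in the context. Then: (i) the periodic points of $S$ are dense in $\mathbb{R}^d$; (ii) $S$ has the blowing-up property everywhere in $\mathbb{R}^d$, that is, $\bigcup_{k=0}^\infty S^k(U)=\mathbb{R}^d$ for every non-empty open set $U\subseteq\mathbb{R}^d$. Equivalently, for every $x\in\mathbb{R}^d$ the backward orbit $O^-(x)=\bigcup_{k=0}^\infty S^{-k}(x)$ is dense in $\mathbb{R}^d$.
   Context: Fix $d\ge2$. Write $H_0=\{x\in\mathbb{R}^d: x_d=0\}$, $B(x,t)$ for the open Euclidean ball, and for a linear map $A$, $\ell(A)=\inf_{\|h\|=1}\|Ah\|$. Let $F$ be a bi-Lipschitz homeomorphism from the half-cube $[-1,1]^{d-1}\times[0,1]$ onto the closed upper half-ball $\{x:\|x\|\le1,x_d\ge0\}$ which maps the face $[-1,1]^{d-1}\times\{1\}$ onto the hemisphere $\{\|x\|=1,x_d\ge0\}$ (hence the remaining faces onto the flat disc in $H_0$), and with $F(0)=0$. Extend $F$ to the half-beam $T_0=[-1,1]^{d-1}\times[0,\infty)$ by $F(x)=e^{x_d-1}F(x_1,\dots,x_{d-1},1)$ for $x_d>1$, so $F$ maps $T_0$ onto $\{x_d\ge0\}$ with $F(\partial T_0)\subseteq H_0$. Then extend $F$ to all of $\mathbb{R}^d$ by repeated reflection: if $\rho$ is the reflection in a hyperplane containing a boundary face of a half-beam on which $F$ is already defined, set $F(\rho(x))=\tau(F(x))$, where $\tau(x_1,\dots,x_d)=(x_1,\dots,x_{d-1},-x_d)$.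 The resulting $F:\mathbb{R}^d\to\mathbb{R}^d$ is quasiregular with $\beta:=\operatorname{ess\,inf}_{x}\ell(DF(x))>0$. Choose $\lambda>4\sqrt{d-1}/\beta$ and set $S=\lambda F$; thus $\alpha:=\operatorname{ess\,inf}_x\ell(DS(x))=\lambda\beta>4\sqrt{d-1}>1$. Half-beams: for $r\in\mathcal{S}=\mathbb{Z}^{d-1}\times\{-1,1\}$, $T(r)=\{x: |x_j-2r_j|\le1\ (1\le j\le d-1),\ r_dx_d\ge0\}$; $S$ maps each $T(r)$ bijectively onto $\{x_d\ge0\}$ or $\{x_d\le0\}$. *)

theory Defs
  imports "HOL-Analysis.Analysis"
begin

text \<open>Coordinates of R^d are indexed by a finite type 'n; a distinguished index k
plays the role of the last coordinate x_d.\<close>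

definition tau :: "'n \<Rightarrow> real^'n \<Rightarrow> real^'n" where
  "tau k y = (\<chi> i. if i = k then - (y $ i) else y $ i)"

definition crefl :: "'n \<Rightarrow> real \<Rightarrow> real^'n \<Rightarrow> real^'n" where
  "crefl j a x = (\<chi> i. if i = j then 2 * a - x $ i else x $ i)"

definition halfcube :: "'n \<Rightarrow> (real^'n) set" where
  "halfcube k = {x. (\<forall>j. j \<noteq> k \<longrightarrow> \<bar>x $ j\<bar> \<le> 1) \<and> 0 \<le> x $ k \<and> x $ k \<le> 1}"

definition upper_halfball :: "'n \<Rightarrow> (real^'n) set" where
  "upper_halfball k = {y. norm y \<le> 1 \<and> 0 \<le> y $ k}"

definition upper_hemisphere :: "'n \<Rightarrow> (real^'n) set" where
  "upper_hemisphere k = {y. norm y = 1 \<and> 0 \<le> y $ k}"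

definition lmin :: "(real^'n \<Rightarrow> real^'n) \<Rightarrow> real" where
  "lmin A = Inf ((\<lambda>h. norm (A h)) ` {h. norm h = 1})"

definition construction_F :: "'n \<Rightarrow> (real^'n \<Rightarrow> real^'n) \<Rightarrow> bool" where
  "construction_F k F \<longleftrightarrow>
     (\<exists>L>0. \<forall>x\<in>halfcube k. \<forall>y\<in>halfcube k.
         dist x y \<le> L * dist (F x) (F y) \<and> dist (F x) (F y) \<le> L * dist x y)
   \<and> F ` halfcube k = upper_halfball k
   \<and> F ` {x \<in> halfcube k. x $ k = 1} = upper_hemisphere k
   \<and> F 0 = 0
   \<and> (\<forall>x. (\<forall>j. j \<noteq> k \<longrightarrow> \<bar>x $ j\<bar> \<le> 1) \<and> x $ k > 1 \<longrightarrow>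
          F x = exp (x $ k - 1) *\<^sub>R F (\<chi> i. if i = k then 1 else x $ i))
   \<and> (\<forall>j m x. j \<noteq> k \<longrightarrow> F (crefl j (2 * real_of_int m + 1) x) = tau k (F x))
   \<and> (\<forall>x. F (crefl k 0 x) = tau k (F x))"

end

(* On the half-beam over the unit cube F has an explicit inverse: the inverse of the bi-Lipschitz
   map on the half-cube, applied to the radial retraction onto the unit ball, plus a logarithm in
   the direction k. It is Lipschitz, and off a null set its local dilatation is at most 1/c, because
   F is differentiable there with lmin at least c; hence on the half-space it is 1/c-Lipschitz. Folding
   by reflections gives, for each half-space and each point, an inverse branch of S = lam F
   between half-spaces which contracts by rate = 1/(lam c) < 1/2.
   Blowing up: the image of a ball contains a half-ball 1/rate times as large, hence a ball
   1/(2 rate) > 1 times as large. A large ball contains a point on a vertical wall; S sends it to the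
   hyperplane, the next iterate of that point has norm at most lam, and what remains is a large
   half-ball centred at 0, whose image contains a large ball centred at 0.
   Periodic points: preimages x of the fixed point 0 are dense. The inverse branch leading from 0
   back to x, composed with many inverse branches fixing 0 and one branch returning to the half-space
   of x, is a strong contraction, and its fixed point is a periodic point near x. *)
theory Submission
  imports Defs
begin

section \<open>Lipschitz bounds from almost everywhere bounds\<close>

text \<open>The exceptional set lies in an open set of small measure, so the crude constant
  \<open>L\<close> is charged only on a short total length. Elsewhere the local bounds chain along
  the interval by bisection, with slope as close to \<open>M\<close> as desired.\<close>

lemma lipschitz_unit_interval_AE:
  fixes g :: "real \<Rightarrow> 'a::real_normed_vector"
  assumes L: "L-lipschitz_on {0..1} g" and E: "negligible E" and M: "0 \<le> M"
    and loc: "\<And>t K. t \<in> {0..1} \<Longrightarrow> t \<notin> E \<Longrightarrow> M < K \<Longrightarrow>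
      \<exists>d>0. \<forall>u\<in>{0..1}. \<bar>u - t\<bar> < d \<longrightarrow> norm (g u - g t) \<le> K * \<bar>u - t\<bar>"
  shows "norm (g 1 - g 0) \<le> M"
proof (rule field_le_epsilon)
  fix e :: real assume e: "e > 0"
  have L0: "L \<ge> 0" using lipschitz_on_nonneg[OF L] .
  \<comment> \<open>This size keeps the total charge \<open>L * e'\<close> below half of
    \<open>e\<close>; the \<open>+ 1\<close> covers \<open>L = 0\<close>.\<close>
  define e' where "e' = e / (2 * (L + 1))"
  have e': "e' > 0" using e L0 by (auto simp: e'_def)
  have Enull: "E \<in> null_sets lebesgue"
    using E negligible_iff_null_sets by blast
  then obtain T where T: "open T" "E \<subseteq> T" "T - E \<in> lmeasurable"
      "emeasure lebesgue (T - E) < ennreal e'"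
    using sets_lebesgue_outer_open[of E e'] e' by blast
  have Tm: "T \<in> lmeasurable"
    using T(2) T(3) negligible_imp_measurable[OF E] fmeasurable.Un[of "T - E" lebesgue E]
    by (simp add: Un_absorb2)
  have mT: "measure lebesgue T \<le> e'"
  proof -
    have "measure lebesgue T = measure lebesgue (T - E)"
      using Enull Tm by (simp add: measure_Diff_null_set fmeasurableD)
    also have "\<dots> \<le> e'"
      using T(4) e' unfolding measure_def by (intro enn2real_leI) auto
    finally show ?thesis .
  qed
  define m where "m a b = measure lebesgue (T \<inter> {a<..b})" for a b
  have madd: "m a b + m b c = m a c" if "a \<le> b" "b \<le> c" for a b c
  proof -
    have "T \<inter> {a<..c} = (T \<inter> {a<..b}) \<union> (T \<inter> {b<..c})" using that by auto
    moreover have "(T \<inter> {a<..b}) \<inter> (T \<inter> {b<..c}) = {}" by auto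
    moreover have "T \<inter> {a<..b} \<in> lmeasurable" "T \<inter> {b<..c} \<in> lmeasurable"
      using Tm by (auto intro: fmeasurable_Int_fmeasurable)
    ultimately show ?thesis unfolding m_def
      by (simp add: measure_Un3 fmeasurableD)
  qed
  have m0: "m a b \<ge> 0" for a b by (simp add: m_def)
  \<comment> \<open>P is additive over adjacent intervals; near E, where only L-Lipschitz continuity is
    available, an interval lies in the small open set T and is paid for by m.\<close>
  define P where "P a b \<longleftrightarrow> (0 \<le> a \<longrightarrow> a \<le> b \<longrightarrow> b \<le> 1 \<longrightarrow>
    norm (g b - g a) \<le> (M + e/2) * (b - a) + L * m a b)" for a b
  have "P 0 1"
  proof (rule Bolzano)
    fix a b c assume trans: "P a b" "P b c" "a \<le> b" "b \<le> c"
    show "P a c" unfolding P_def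
    proof (intro impI)
      assume "0 \<le> a" "a \<le> c" "c \<le> 1"
      then have "norm (g b - g a) \<le> (M + e/2) * (b - a) + L * m a b"
        "norm (g c - g b) \<le> (M + e/2) * (c - b) + L * m b c"
        using trans unfolding P_def by auto
      moreover have "norm (g c - g a) \<le> norm (g b - g a) + norm (g c - g b)"
        using norm_triangle_ineq[of "g b - g a" "g c - g b"] by simp
      moreover have "m a c = m a b + m b c" using madd trans by simp
      moreover have "(M + e/2) * (c - a) = (M + e/2) * (b - a) + (M + e/2) * (c - b)"
        by (simp only: distrib_left[symmetric]) simp
      ultimately show "norm (g c - g a) \<le> (M + e/2) * (c - a) + L * m a c"
        by (simp add: distrib_left)
    qed
  next
    fix x :: real assume local: "0 \<le> x" "x \<le> 1"
    show "\<exists>d>0. \<forall>a b. a \<le> x \<and> x \<le> b \<and> b - a < d \<longrightarrow> P a b"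
    proof (cases "x \<in> E")
      case True
      then obtain d where d: "d > 0" "ball x d \<subseteq> T" using T openE by blast
      show ?thesis
      proof (intro exI[of _ d] conjI allI impI d)
        fix a b assume ab: "a \<le> x \<and> x \<le> b \<and> b - a < d"
        show "P a b" unfolding P_def
        proof (intro impI)
          assume *: "0 \<le> a" "a \<le> b" "b \<le> 1"
          have "{a<..b} \<subseteq> ball x d" using ab by (auto simp: dist_real_def)
          then have "T \<inter> {a<..b} = {a<..b}" using d by blast
          then have "m a b = b - a" using * by (simp add: m_def)
          moreover have "norm (g b - g a) \<le> L * (b - a)"
            using lipschitz_onD[OF L, of b a] * by (simp add: dist_norm)
          moreover have "0 \<le> (M + e/2) * (b - a)" using * M e by simp
          ultimately show "norm (g b - g a) \<le> (M + e/2) * (b - a) + L * m a b"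
            by simp
        qed
      qed
    next
      case False
      obtain d where d: "d > 0"
        "\<And>u. u \<in> {0..1} \<Longrightarrow> \<bar>u - x\<bar> < d \<Longrightarrow> norm (g u - g x) \<le> (M + e/2) * \<bar>u - x\<bar>"
        using loc[of x "M + e/2"] False local e by auto
      show ?thesis
      proof (intro exI[of _ d] conjI allI impI d)
        fix a b assume ab: "a \<le> x \<and> x \<le> b \<and> b - a < d"
        show "P a b" unfolding P_def
        proof (intro impI)
          assume *: "0 \<le> a" "a \<le> b" "b \<le> 1"
          have "norm (g b - g x) \<le> (M + e/2) * (b - x)" "norm (g a - g x) \<le> (M + e/2) * (x - a)"
            using d(2)[of b] d(2)[of a] ab * by auto
          moreover have "norm (g b - g a) \<le> norm (g b - g x) + norm (g a - g x)"
            by (metis dist_norm dist_triangle2)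
          moreover have "0 \<le> L * m a b" using L0 m0 by simp
          moreover have "(M + e/2) * (b - a) = (M + e/2) * (b - x) + (M + e/2) * (x - a)"
            by (simp only: distrib_left[symmetric]) simp
          ultimately show "norm (g b - g a) \<le> (M + e/2) * (b - a) + L * m a b"
            by linarith
        qed
      qed
    qed
  qed simp
  then have "norm (g 1 - g 0) \<le> M + e/2 + L * m 0 1" by (simp add: P_def)
  moreover have "m 0 1 \<le> e'"
  proof -
    have "T \<inter> {0<..1} \<in> sets lebesgue" using Tm by (auto simp: fmeasurableD)
    then show ?thesis
      unfolding m_def using measure_mono_fmeasurable[of "T \<inter> {0<..1}" T lebesgue] Tm mT by auto
  qed
  then have "L * m 0 1 \<le> L * e'" using L0 by (rule mult_left_mono)
  moreover have "L * e' \<le> e / 2" using L0 e by (simp add: e'_def field_simps)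
  ultimately show "norm (g 1 - g 0) \<le> M + e" by simp
qed

text \<open>Fubini, by exchanging the quantifiers: for fixed \<open>t\<close> the bad
  \<open>z\<close> form a translate of a null set.\<close>

lemma negligible_AE_line:
  fixes Z :: "'a::euclidean_space set"
  assumes "negligible Z"
  shows "AE z in lborel. AE t in lborel. z + t *\<^sub>R v \<notin> Z"
proof -
  have "Z \<in> null_sets (completion lborel)" using assms negligible_iff_null_sets by blast
  \<comment> \<open>A Borel null superset replaces \<open>Z\<close>, because the exchange needs
    measurability in the product.\<close>
  then obtain N where N: "N \<in> null_sets lborel" "Z \<subseteq> N"
    by (auto simp: null_sets_completion_iff2)
  have "AE t::real in lborel. AE z in lborel. z + t *\<^sub>R v \<notin> N"
  proof (rule AE_I2)
    fix t :: real
    have "{z. z - (- (t *\<^sub>R v)) \<in> N} \<in> null_sets lborel"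
      by (rule null_sets_translation[OF N(1)])
    from AE_not_in[OF this] show "AE z in lborel. z + t *\<^sub>R v \<notin> N" by simp
  qed
  moreover have "{x \<in> space (lborel \<Otimes>\<^sub>M lborel). fst x + snd x *\<^sub>R v \<notin> N}
      \<in> sets (lborel \<Otimes>\<^sub>M (lborel::real measure))"
  proof -
    have "N \<in> sets borel" using N(1) by auto
    then have "(\<lambda>x. fst x + snd x *\<^sub>R v) -` (- N) \<inter> space (lborel \<Otimes>\<^sub>M lborel)
        \<in> sets (lborel \<Otimes>\<^sub>M (lborel::real measure))"
      by (intro measurable_sets[where A = borel]) (auto simp: borel_comp)
    then show ?thesis by (simp add: vimage_def Int_def conj_commute)
  qed
  ultimately have "AE z in lborel. AE t::real in lborel. z + t *\<^sub>R v \<notin> N"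
    using lborel_pair.AE_commute[of "\<lambda>z t. z + t *\<^sub>R v \<notin> N"] by simp
  then show ?thesis
    by eventually_elim (use N(2) in \<open>auto elim!: eventually_mono\<close>)
qed

lemma AE_lborel_open_ex:
  fixes U :: "'a::euclidean_space set"
  assumes "AE z in lborel. P z" "open U" "U \<noteq> {}"
  obtains z where "z \<in> U" "P z"
proof -
  obtain N where N: "{z. \<not> P z} \<subseteq> N" "N \<in> null_sets lborel"
    using assms(1) by (auto elim!: AE_E simp: null_sets_def)
  then have "negligible N"
    using null_sets_completionI negligible_iff_null_sets by blast
  then have "\<not> U \<subseteq> N"
    using open_not_negligible[OF assms(2,3)] negligible_subset by blast
  then show ?thesis using that N(1) by blast
qed

text \<open>Almost every translate of a given segment meets Z in a null set, so the one-dimensional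
  bound applies to segments arbitrarily close to the given one.\<close>

lemma lipschitz_on_convex_AE:
  fixes f :: "'a::euclidean_space \<Rightarrow> 'b::real_normed_vector"
  assumes C: "convex C" "open C" and L: "L-lipschitz_on C f" and Z: "negligible Z" and M: "0 \<le> M"
    and loc: "\<And>y K. y \<in> C \<Longrightarrow> y \<notin> Z \<Longrightarrow> M < K \<Longrightarrow>
      \<exists>d>0. \<forall>u\<in>C. dist u y < d \<longrightarrow> dist (f u) (f y) \<le> K * dist u y"
  shows "M-lipschitz_on C f"
proof (rule lipschitz_onI)
  fix b a assume ab: "b \<in> C" "a \<in> C"
  define v where "v = b - a"
  show "dist (f b) (f a) \<le> M * dist b a"
  proof (cases "v = 0")
    case True
    then show ?thesis by (simp add: v_def)
  next
    case v: False
    show ?thesis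
    proof (rule field_le_epsilon)
      fix e :: real assume e: "e > 0"
      have L0: "L \<ge> 0" using lipschitz_on_nonneg[OF L] .
      obtain d1 where d1: "d1 > 0" "ball a d1 \<subseteq> C" using C(2) ab openE by blast
      obtain d2 where d2: "d2 > 0" "ball b d2 \<subseteq> C" using C(2) ab openE by blast
      \<comment> \<open>Moving the segment by less than \<open>d\<close> keeps its endpoints in
        \<open>C\<close> and changes each endpoint value of \<open>f\<close> by at most half of the
        permitted error \<open>e\<close>.\<close>
      define d where "d = min (min d1 d2) (e / (2 * (L + 1)))"
      have d: "d > 0" using d1 d2 e L0 by (auto simp: d_def)
      obtain z where z: "z \<in> ball a d" "AE t in lborel. z + t *\<^sub>R v \<notin> Z"
        using AE_lborel_open_ex[OF negligible_AE_line[OF Z, of v], of "ball a d"] d by auto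
      have zC: "z \<in> C" using z(1) d1 by (auto simp: d_def)
      have dzb: "dist (z + v) b < d" using z(1)
        by (simp add: v_def dist_norm algebra_simps norm_minus_commute)
      have zvC: "z + v \<in> C" using dzb d2 by (auto simp: d_def dist_commute)
      have seg: "z + t *\<^sub>R v \<in> C" if "t \<in> {0..1}" for t
        using convexD_alt[OF C(1) zC zvC, of t] that by (simp add: algebra_simps)
      define E where "E = {t. z + t *\<^sub>R v \<in> Z}"
      have E: "negligible E"
      proof -
        obtain N where "{t. \<not> z + t *\<^sub>R v \<notin> Z} \<subseteq> N" "N \<in> null_sets lborel"
          using z(2) by (auto elim!: AE_E simp: null_sets_def)
        then have "E \<subseteq> N" "negligible N"
          unfolding E_def using null_sets_completionI negligible_iff_null_sets by auto
        then show ?thesis using negligible_subset by blast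
      qed
      have nv: "norm v > 0" using v by simp
      have "norm (f (z + 1 *\<^sub>R v) - f (z + 0 *\<^sub>R v)) \<le> M * norm v"
      proof (rule lipschitz_unit_interval_AE[where g = "\<lambda>t. f (z + t *\<^sub>R v)" and E = E
            and L = "L * norm v"])
        show "(L * norm v)-lipschitz_on {0..1} (\<lambda>t. f (z + t *\<^sub>R v))"
        proof (rule lipschitz_onI)
          fix s t :: real assume "s \<in> {0..1}" "t \<in> {0..1}"
          then have "dist (f (z + s *\<^sub>R v)) (f (z + t *\<^sub>R v)) \<le> L * dist (z + s *\<^sub>R v) (z + t *\<^sub>R v)"
            using lipschitz_onD[OF L] seg by blast
          also have "dist (z + s *\<^sub>R v) (z + t *\<^sub>R v) = norm v * dist s t"
            by (simp add: dist_norm scaleR_diff_left[symmetric])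
          finally show "dist (f (z + s *\<^sub>R v)) (f (z + t *\<^sub>R v)) \<le> L * norm v * dist s t"
            by (simp add: mult.assoc)
        qed (use L0 in simp)
      next
        fix t K :: real assume t: "t \<in> {0..1}" "t \<notin> E" "M * norm v < K"
        \<comment> \<open>The segment is traversed at speed \<open>norm v\<close>, so slope
          \<open>K\<close> in the parameter is slope \<open>K / norm v\<close> in space.\<close>
        have "M < K / norm v" using t(3) nv by (simp add: pos_less_divide_eq)
        moreover have "z + t *\<^sub>R v \<notin> Z" using t by (simp add: E_def)
        ultimately obtain r where r: "r > 0" "\<And>u. u \<in> C \<Longrightarrow> dist u (z + t *\<^sub>R v) < r \<Longrightarrow>
            dist (f u) (f (z + t *\<^sub>R v)) \<le> K / norm v * dist u (z + t *\<^sub>R v)"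
          using loc[OF seg[OF t(1)]] by blast
        show "\<exists>d>0. \<forall>u\<in>{0..1}. \<bar>u - t\<bar> < d \<longrightarrow>
            norm (f (z + u *\<^sub>R v) - f (z + t *\<^sub>R v)) \<le> K * \<bar>u - t\<bar>"
        proof (intro exI[of _ "r / norm v"] conjI ballI impI)
          fix u :: real assume u: "u \<in> {0..1}" "\<bar>u - t\<bar> < r / norm v"
          have eq: "dist (z + u *\<^sub>R v) (z + t *\<^sub>R v) = \<bar>u - t\<bar> * norm v"
            by (simp add: dist_norm scaleR_diff_left[symmetric])
          then have "dist (z + u *\<^sub>R v) (z + t *\<^sub>R v) < r"
            using u(2) nv by (simp add: pos_less_divide_eq)
          from r(2)[OF seg[OF u(1)] this]
          show "norm (f (z + u *\<^sub>R v) - f (z + t *\<^sub>R v)) \<le> K * \<bar>u - t\<bar>"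
            using nv by (simp add: eq dist_norm[of "f _"])
        qed (use r(1) nv in simp)
      qed (use E M in auto)
      then have 1: "dist (f (z + v)) (f z) \<le> M * dist b a" by (simp add: dist_norm v_def)
      have 2: "dist (f b) (f (z + v)) \<le> L * d"
        using lipschitz_onD[OF L ab(1) zvC] dzb L0
        by (smt (verit) dist_commute mult_left_mono)
      have 3: "dist (f z) (f a) \<le> L * d"
        using lipschitz_onD[OF L zC ab(2)] z(1) L0
        by (smt (verit) dist_commute mem_ball mult_left_mono)
      have "L * d \<le> L * (e / (2 * (L + 1)))"
        using L0 by (intro mult_left_mono) (auto simp: d_def)
      also have "\<dots> \<le> e / 2" using L0 e by (simp add: field_simps)
      finally have 4: "L * d \<le> e / 2" .
      have "dist (f b) (f a) \<le> dist (f b) (f (z + v)) + dist (f (z + v)) (f z) + dist (f z) (f a)"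
        by (meson dist_triangle order_trans add_mono order_refl)
      then show "dist (f b) (f a) \<le> M * dist b a + e" using 1 2 3 4 by linarith
    qed
  qed
qed (use M in simp)

section \<open>Preliminaries\<close>

definition retr :: "'a::real_normed_vector \<Rightarrow> 'a" where
  "retr y = (1 / max 1 (norm y)) *\<^sub>R y"

text \<open>Any finite constant serves: the sharp bound for \<open>Finv\<close> comes later from the
  derivative of \<open>F\<close>.\<close>

lemma retr_lipschitz: "dist (retr y) (retr z) \<le> 2 * dist y z"
proof -
  define p q where "p = max 1 (norm y)" and "q = max 1 (norm z)"
  have p: "p \<ge> 1" "q \<ge> 1" "norm z \<le> q" and pq: "\<bar>q - p\<bar> \<le> dist y z"
    using norm_triangle_ineq3[of z y] by (auto simp: p_def q_def dist_norm norm_minus_commute)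
  have "retr y - retr z = (1 / p) *\<^sub>R (y - z) + ((q - p) / (p * q)) *\<^sub>R z"
    using p by (simp add: retr_def p_def[symmetric] q_def[symmetric] algebra_simps
        scaleR_add_left[symmetric] diff_divide_distrib)
  then have "dist (retr y) (retr z) \<le> norm ((1 / p) *\<^sub>R (y - z)) + norm (((q - p) / (p * q)) *\<^sub>R z)"
    by (simp only: dist_norm norm_triangle_ineq)
  also have "norm ((1 / p) *\<^sub>R (y - z)) \<le> dist y z"
    using p by (simp add: dist_norm divide_le_eq mult_le_cancel_left1)
  also have "norm (((q - p) / (p * q)) *\<^sub>R z) \<le> dist y z"
  proof -
    have "norm (((q - p) / (p * q)) *\<^sub>R z) = (\<bar>q - p\<bar> / p) * (norm z / q)"
      using p by (simp add: abs_mult)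
    also have "\<dots> \<le> \<bar>q - p\<bar> * 1"
      using p by (intro mult_mono) (auto simp: divide_le_eq mult_le_cancel_left1)
    finally show ?thesis using pq by simp
  qed
  finally show ?thesis by simp
qed

lemma ln_max_lipschitz:
  fixes y z :: "'a::real_normed_vector"
  shows "\<bar>ln (max 1 (norm y)) - ln (max 1 (norm z))\<bar> \<le> dist y z"
proof -
  have *: "ln p - ln q \<le> \<bar>p - q\<bar>" if "p \<ge> 1" "q \<ge> 1" for p q :: real
  proof -
    have "ln p - ln q \<le> (p - q) / q" using that by (intro ln_diff_le) auto
    also have "\<dots> \<le> \<bar>p - q\<bar> / q" using that by (simp add: divide_right_mono)
    also have "\<dots> \<le> \<bar>p - q\<bar>" using that by (simp add: divide_le_eq mult_le_cancel_left1)
    finally show ?thesis .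
  qed
  have "\<bar>ln p - ln q\<bar> \<le> \<bar>p - q\<bar>" if "p \<ge> 1" "q \<ge> 1" for p q :: real
    using *[OF that] *[OF that(2,1)] by linarith
  then have "\<bar>ln (max 1 (norm y)) - ln (max 1 (norm z))\<bar> \<le> \<bar>max 1 (norm y) - max 1 (norm z)\<bar>"
    by simp
  also have "\<dots> \<le> dist y z"
    using norm_triangle_ineq3[of y z] by (auto simp: dist_norm)
  finally show ?thesis .
qed

lemma lmin_le:
  assumes "bounded_linear D"
  shows "lmin D * norm h \<le> norm (D h)"
proof (cases "h = 0")
  case False
  interpret bounded_linear D by fact
  have "lmin D \<le> norm (D ((1 / norm h) *\<^sub>R h))"
    unfolding lmin_def using False by (intro cINF_lower bdd_belowI2[where m = 0]) auto
  then show ?thesis using False by (simp add: scaleR pos_le_divide_eq)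
qed simp

lemma norm_sign_change:
  fixes w :: "real^'n"
  shows "norm (\<chi> i. if i = j then - (w $ i) else w $ i) = norm w"
proof -
  have "(\<Sum>i\<in>UNIV. (if i = j then - (w $ i) else w $ i)\<^sup>2) = (\<Sum>i\<in>UNIV. (w $ i)\<^sup>2)"
    by (intro sum.cong) auto
  then show ?thesis by (simp add: norm_vec_def L2_set_def)
qed

lemma dist_crefl: "dist (crefl j a u) (crefl j a v) = dist u (v :: real^'n)"
proof -
  have "crefl j a u - crefl j a v = (\<chi> i. if i = j then - ((u - v) $ i) else (u - v) $ i)"
    by (simp add: crefl_def vec_eq_iff)
  then show ?thesis by (simp add: dist_norm norm_sign_change)
qed

lemma surj_crefl: "surj (crefl j a :: real^'n \<Rightarrow> real^'n)"
  by (rule surjI[where f = "crefl j a"]) (simp add: crefl_def vec_eq_iff)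

lemma dense_if_meets_open:
  assumes "\<And>U :: 'a::topological_space set. open U \<Longrightarrow> U \<noteq> {} \<Longrightarrow> \<exists>x\<in>U. x \<in> X"
  shows "closure X = UNIV"
  using assms[of "- closure X"] closure_subset[of X] by auto

section \<open>Inverse branches\<close>

text \<open>The 2 in \<open>expanding\<close> pays for the halving in \<open>ball_growth\<close>:
  the full ball placed inside a half-ball has only half its radius.\<close>

locale quasiregular_sine =
  fixes k :: "'n::finite" and F :: "real^'n \<Rightarrow> real^'n" and lam c :: real
  assumes construction: "construction_F k F"
    and card: "CARD('n) \<ge> 2"
    and lam: "lam > 0"
    and expanding: "lam * c > 2"
    and deriv: "AE x in lebesgue. \<exists>D. (F has_derivative D) (at x) \<and> lmin D \<ge> c"
begin

definition S :: "real^'n \<Rightarrow> real^'n" where "S x = lam *\<^sub>R F x"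

text \<open>The sign is a real number, so symmetries act on half-spaces by multiplying signs. Both
  half-spaces are closed and share the hyperplane, whose points can thus be used from either
  side.\<close>

definition half :: "real \<Rightarrow> (real^'n) set" where "half s = {x. 0 \<le> s * x $ k}"

definition beam :: "(real^'n) set" where "beam = {x. (\<forall>j. j \<noteq> k \<longrightarrow> \<bar>x $ j\<bar> \<le> 1) \<and> 0 \<le> x $ k}"

text \<open>Truncation at height 1 merges the map on the half-cube and its exponential extension
  into the single formula \<open>F_beam\<close>.\<close>

definition clip :: "real^'n \<Rightarrow> real^'n" where "clip x = (\<chi> i. if i = k then min 1 (x $ k) else x $ i)"

definition G :: "real^'n \<Rightarrow> real^'n" where "G = inv_into (halfcube k) F"

text \<open>For \<open>y\<close> in the upper half-space: inside the unit ball the logarithm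
  vanishes; outside, \<open>retr y\<close> lies on the hemisphere, its preimage has height 1, and
  the logarithm undoes the exponential factor of \<open>F\<close>.\<close>

definition Finv :: "real^'n \<Rightarrow> real^'n"
  where "Finv y = G (retr y) + ln (max 1 (norm y)) *\<^sub>R axis k 1"

lemma c_pos: "c > 0"
  using expanding lam zero_less_mult_pos[of lam c] by simp

lemmas construction_facts = construction[unfolded construction_F_def]
lemmas bilipschitz = construction_facts[THEN conjunct1]
lemmas F_halfcube = construction_facts[THEN conjunct2, THEN conjunct1]
lemmas F_top_face = construction_facts[THEN conjunct2, THEN conjunct2, THEN conjunct1]
lemmas F_0 = construction_facts[THEN conjunct2, THEN conjunct2, THEN conjunct2, THEN conjunct1]
lemmas F_reflections = construction_facts[THEN conjunct2, THEN conjunct2, THEN conjunct2, THEN conjunct2]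
lemmas F_extension = F_reflections[THEN conjunct1, rule_format]
lemmas F_crefl = F_reflections[THEN conjunct2, THEN conjunct1, rule_format]
lemmas F_crefl_k = F_reflections[THEN conjunct2, THEN conjunct2, rule_format]

section \<open>The inverse of F on the half-beam and its Lipschitz constant\<close>

lemma inj_F_halfcube: "inj_on F (halfcube k)"
proof (rule inj_onI)
  fix x y assume *: "x \<in> halfcube k" "y \<in> halfcube k" "F x = F y"
  obtain L where L: "L > 0"
    "\<And>x y. x \<in> halfcube k \<Longrightarrow> y \<in> halfcube k \<Longrightarrow> dist x y \<le> L * dist (F x) (F y)"
    "\<And>x y. x \<in> halfcube k \<Longrightarrow> y \<in> halfcube k \<Longrightarrow> dist (F x) (F y) \<le> L * dist x y"
    using bilipschitz by blast
  from L(2)[OF *(1,2)] show "x = y" using *(3) by simp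
qed

lemma G_F: "x \<in> halfcube k \<Longrightarrow> G (F x) = x"
  by (simp add: G_def inj_F_halfcube)

lemma G_halfball:
  assumes "y \<in> upper_halfball k"
  shows "G y \<in> halfcube k" "F (G y) = y"
  using assms F_halfcube by (auto simp: G_def inv_into_into f_inv_into_f)

lemma G_hemisphere:
  assumes "norm y = 1" "y $ k \<ge> 0"
  shows "G y $ k = 1"
proof -
  have "y \<in> F ` {x \<in> halfcube k. x $ k = 1}"
    using assms by (simp only: F_top_face upper_hemisphere_def mem_Collect_eq)
  then show ?thesis using G_F by auto
qed

lemma norm_F_top_face: "x \<in> halfcube k \<Longrightarrow> x $ k = 1 \<Longrightarrow> norm (F x) = 1"
  using F_top_face by (force simp: upper_hemisphere_def)

lemma F_halfcube_bounds:
  assumes "x \<in> halfcube k"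
  shows "norm (F x) \<le> 1" "F x $ k \<ge> 0"
  using F_halfcube assms by (auto simp: upper_halfball_def)

lemma clip_halfcube: "x \<in> beam \<Longrightarrow> clip x \<in> halfcube k"
  by (auto simp: beam_def halfcube_def clip_def)

lemma F_beam:
  assumes "x \<in> beam"
  shows "F x = exp (max 0 (x $ k - 1)) *\<^sub>R F (clip x)"
proof (cases "x $ k > 1")
  case True
  then have "clip x = (\<chi> i. if i = k then 1 else x $ i)"
    by (auto simp: clip_def vec_eq_iff)
  then show ?thesis using F_extension[of x] assms True by (simp add: beam_def)
next
  case False
  then have "clip x = x" by (auto simp: clip_def vec_eq_iff)
  then show ?thesis using False by simp
qed

lemma F_beam_half: "x \<in> beam \<Longrightarrow> F x $ k \<ge> 0"
  using F_beam F_halfcube_bounds(2) clip_halfcube by simp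

lemma Finv_F:
  assumes x: "x \<in> beam"
  shows "Finv (F x) = x"
proof (cases "x $ k > 1")
  case True
  have n: "norm (F (clip x)) = 1"
    using norm_F_top_face clip_halfcube[OF x] True by (simp add: clip_def)
  then have nF: "norm (F x) = exp (x $ k - 1)"
    using F_beam[OF x] True by simp
  then have m: "max 1 (norm (F x)) = exp (x $ k - 1)" using True by simp
  then have "retr (F x) = F (clip x)"
    using F_beam[OF x] True by (simp add: retr_def)
  then have "Finv (F x) = clip x + (x $ k - 1) *\<^sub>R axis k 1"
    using m G_F[OF clip_halfcube[OF x]] by (simp add: Finv_def)
  also have "\<dots> = x" using True by (auto simp: clip_def vec_eq_iff axis_def)
  finally show ?thesis .
next
  case False
  then have xh: "x \<in> halfcube k" using x by (auto simp: beam_def halfcube_def)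
  then have "max 1 (norm (F x)) = 1" using F_halfcube_bounds(1) by simp
  then show ?thesis using G_F[OF xh] by (simp add: Finv_def retr_def)
qed

lemma retr_halfball: "y $ k \<ge> 0 \<Longrightarrow> retr y \<in> upper_halfball k"
  by (auto simp: retr_def upper_halfball_def max_def)

lemma Finv_right_inverse:
  assumes y: "y $ k \<ge> 0"
  shows "Finv y \<in> beam" "F (Finv y) = y"
proof -
  define z where "z = G (retr y)"
  have z: "z \<in> halfcube k" "F z = retr y"
    using G_halfball[OF retr_halfball[OF y]] by (auto simp: z_def)
  have Fi: "Finv y = z + ln (max 1 (norm y)) *\<^sub>R axis k 1" by (simp add: Finv_def z_def)
  show b: "Finv y \<in> beam"
    using z(1) by (auto simp: Fi beam_def halfcube_def axis_def)
  show "F (Finv y) = y"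
  proof (cases "norm y > 1")
    case True
    then have "norm (retr y) = 1" "retr y $ k \<ge> 0" using y by (auto simp: retr_def)
    then have zk: "z $ k = 1" using G_hemisphere by (simp add: z_def)
    have Fk: "Finv y $ k = 1 + ln (norm y)" using zk True by (simp add: Fi)
    moreover have "clip (Finv y) = z"
      using zk Fk True by (auto simp: clip_def vec_eq_iff Fi axis_def)
    ultimately have "F (Finv y) = exp (ln (norm y)) *\<^sub>R retr y"
      using F_beam[OF b] z(2) True by simp
    also have "\<dots> = y"
    proof -
      have "exp (ln (norm y)) = norm y" "max 1 (norm y) = norm y" "norm y \<noteq> 0" using True by auto
      then show ?thesis by (simp only: retr_def) simp
    qed
    finally show ?thesis .
  next
    case False
    then show ?thesis using z(2) by (simp add: Fi retr_def)
  qed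
qed

text \<open>A crude bound from the bi-Lipschitz constant on the half-cube. It is the a priori
  Lipschitz continuity from which \<open>Finv_contraction\<close> starts.\<close>

lemma Finv_lipschitz:
  obtains L where "L-lipschitz_on (half 1) Finv"
proof -
  obtain L where L: "L > 0"
    "\<And>x y. x \<in> halfcube k \<Longrightarrow> y \<in> halfcube k \<Longrightarrow> dist x y \<le> L * dist (F x) (F y)"
    "\<And>x y. x \<in> halfcube k \<Longrightarrow> y \<in> halfcube k \<Longrightarrow> dist (F x) (F y) \<le> L * dist x y"
    using bilipschitz by blast
  have "(L * 2 + 1)-lipschitz_on (half 1) Finv"
  proof (rule lipschitz_onI)
    fix y z assume "y \<in> half 1" "z \<in> half 1"
    then have yz: "y $ k \<ge> 0" "z $ k \<ge> 0" by (auto simp: half_def)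
    have "dist (G (retr y)) (G (retr z)) \<le> L * dist (retr y) (retr z)"
      using L(2)[OF G_halfball(1)[OF retr_halfball[OF yz(1)]] G_halfball(1)[OF retr_halfball[OF yz(2)]]]
        G_halfball(2)[OF retr_halfball[OF yz(1)]] G_halfball(2)[OF retr_halfball[OF yz(2)]]
      by simp
    also have "\<dots> \<le> L * (2 * dist y z)" using retr_lipschitz L(1) by simp
    finally have 1: "dist (G (retr y)) (G (retr z)) \<le> L * 2 * dist y z" by simp
    let ?a = "axis k 1 :: real^'n"
    have 2: "dist (ln (max 1 (norm y)) *\<^sub>R ?a) (ln (max 1 (norm z)) *\<^sub>R ?a) \<le> dist y z"
      using ln_max_lipschitz[of y z] by (simp add: dist_norm scaleR_diff_left[symmetric])
    show "dist (Finv y) (Finv z) \<le> (L * 2 + 1) * dist y z"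
      using dist_triangle_add[of "G (retr y)" "ln (max 1 (norm y)) *\<^sub>R ?a" "G (retr z)"
          "ln (max 1 (norm z)) *\<^sub>R ?a"] 1 2
      by (simp add: Finv_def algebra_simps)
  qed (use L in simp)
  then show ?thesis by (rule that)
qed

text \<open>Carries the null set on which the derivative bound may fail over to the image side,
  where \<open>Finv\<close> is studied. On the half-beam \<open>F\<close> is locally Lipschitz,
  being a locally Lipschitz exponential times the bounded Lipschitz map \<open>F\<close> after
  \<open>clip\<close>.\<close>

lemma negligible_F_image:
  assumes "negligible N" "N \<subseteq> beam"
  shows "negligible (F ` N)"
proof (rule negligible_locally_Lipschitz_image[OF order_refl assms(1)])
  fix x assume "x \<in> N"
  then have x: "x \<in> beam" using assms(2) by blast
  obtain L where L: "L > 0"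
    "\<And>x y. x \<in> halfcube k \<Longrightarrow> y \<in> halfcube k \<Longrightarrow> dist x y \<le> L * dist (F x) (F y)"
    "\<And>x y. x \<in> halfcube k \<Longrightarrow> y \<in> halfcube k \<Longrightarrow> dist (F x) (F y) \<le> L * dist x y"
    using bilipschitz by blast
  define p where "p y = max 0 (y $ k - 1)" for y :: "real^'n"
  \<comment> \<open>Since \<open>p\<close> is 1-Lipschitz, \<open>Q\<close> bounds the exponents on
    the whole unit ball around \<open>x\<close>.\<close>
  define Q where "Q = p x + 1"
  have exp_diff: "\<bar>exp a - exp b\<bar> \<le> exp Q * \<bar>a - b\<bar>" if "a \<le> Q" "b \<le> Q" for a b
  proof -
    have *: "exp a - exp b \<le> exp Q * \<bar>a - b\<bar>" if "a \<le> Q" for a b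
    proof -
      have "exp a - exp b = exp a * (1 - exp (b - a))" by (simp add: exp_diff algebra_simps)
      also have "\<dots> \<le> exp a * \<bar>a - b\<bar>"
      proof -
        have "1 - exp (b - a) \<le> \<bar>a - b\<bar>" using exp_ge_add_one_self[of "b - a"] by linarith
        then show ?thesis by simp
      qed
      also have "\<dots> \<le> exp Q * \<bar>a - b\<bar>" using that by (intro mult_right_mono) auto
      finally show ?thesis .
    qed
    show ?thesis using *[OF that(1), of b] *[OF that(2), of a] by (simp add: abs_le_iff abs_minus_commute)
  qed
  have p_lip: "\<bar>p y - p x\<bar> \<le> norm (y - x)" for y
    using component_le_norm_cart[of "y - x" k] by (auto simp: p_def)
  have clip_lip: "dist (clip y) (clip x) \<le> norm (y - x)" for y
    unfolding dist_norm by (rule norm_le_componentwise_cart) (auto simp: clip_def)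
  show "\<exists>T B. open T \<and> x \<in> T \<and> (\<forall>y\<in>N \<inter> T. norm (F y - F x) \<le> B * norm (y - x))"
  proof (intro exI conjI ballI)
    show "open (ball x 1)" "x \<in> ball x 1" by auto
    fix y assume "y \<in> N \<inter> ball x 1"
    then have y: "y \<in> beam" "norm (y - x) < 1"
      using assms(2) by (auto simp: dist_norm norm_minus_commute)
    have pQ: "p y \<le> Q" "p x \<le> Q" using p_lip[of y] y(2) by (auto simp: Q_def)
    have "F y - F x = (exp (p y) - exp (p x)) *\<^sub>R F (clip y) + exp (p x) *\<^sub>R (F (clip y) - F (clip x))"
      using F_beam[OF x] F_beam[OF y(1)] by (simp add: p_def algebra_simps)
    then have "norm (F y - F x) \<le> norm ((exp (p y) - exp (p x)) *\<^sub>R F (clip y))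
        + norm (exp (p x) *\<^sub>R (F (clip y) - F (clip x)))"
      by (simp only: norm_triangle_ineq)
    also have "norm ((exp (p y) - exp (p x)) *\<^sub>R F (clip y)) \<le> (exp Q * norm (y - x)) * 1"
    proof -
      have "\<bar>exp (p y) - exp (p x)\<bar> \<le> exp Q * norm (y - x)"
        using exp_diff[OF pQ] p_lip[of y] by (meson exp_ge_zero mult_left_mono order_trans)
      from mult_mono[OF this F_halfcube_bounds(1)[OF clip_halfcube[OF y(1)]]] show ?thesis
        by simp
    qed
    also have "norm (exp (p x) *\<^sub>R (F (clip y) - F (clip x))) \<le> exp (p x) * (L * norm (y - x))"
    proof -
      have "norm (F (clip y) - F (clip x)) \<le> L * norm (y - x)"
        using order_trans[OF L(3)[OF clip_halfcube[OF y(1)] clip_halfcube[OF x]]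
            mult_left_mono[OF clip_lip[of y]]] L(1) by (simp add: dist_norm)
      then show ?thesis by simp
    qed
    finally show "norm (F y - F x) \<le> (exp Q + exp (p x) * L) * norm (y - x)"
      by (simp add: algebra_simps)
  qed
qed

text \<open>Where \<open>F\<close> expands infinitesimally by at least \<open>c\<close>, its inverse
  has local dilatation at most \<open>1 / c\<close>. Convexity of the half-space makes this almost
  everywhere bound global, free of the bi-Lipschitz constant.\<close>

lemma Finv_contraction: "(1 / c)-lipschitz_on (half 1) Finv"
proof -
  obtain L where L: "L-lipschitz_on (half 1) Finv" by (rule Finv_lipschitz)
  obtain N where N: "{x. \<not> (\<exists>D. (F has_derivative D) (at x) \<and> lmin D \<ge> c)} \<subseteq> N"
    "N \<in> null_sets lebesgue"
    using deriv by (auto elim!: AE_E simp: null_sets_def)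
  define Z where "Z = F ` (N \<inter> beam)"
  have Z: "negligible Z"
    unfolding Z_def using N(2) negligible_iff_null_sets
    by (intro negligible_F_image) (auto intro: negligible_Int)
  \<comment> \<open>The segment argument needs an open set; continuity then extends the bound to the
    closed half-space.\<close>
  define C where "C = {y::real^'n. 0 < y $ k}"
  have C: "C \<subseteq> half 1" by (auto simp: C_def half_def)
  have cl: "closure C = half 1"
    by (simp add: C_def half_def)
  have "(1 / c)-lipschitz_on C Finv"
  proof (rule lipschitz_on_convex_AE[OF _ _ lipschitz_on_subset[OF L C] Z])
    show "convex C"
      using convex_halfspace_gt[of 0 "axis k 1 :: real^'n"] by (simp add: C_def inner_axis' )
    show "open C" unfolding C_def by (intro open_Collect_less continuous_intros)
    fix y K assume y: "y \<in> C" "y \<notin> Z" and K: "1 / c < K"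
    have Kpos: "K > 0" using K c_pos by (smt (verit) divide_pos_pos)
    define x where "x = Finv y"
    have yk: "y $ k \<ge> 0" using y by (auto simp: C_def)
    have x: "x \<in> beam" "F x = y" using Finv_right_inverse[OF yk] by (auto simp: x_def)
    then have "x \<notin> N" using y(2) by (auto simp: Z_def)
    then obtain D where D: "(F has_derivative D) (at x)" "lmin D \<ge> c" using N(1) by blast
    \<comment> \<open>The linearisation error may consume \<open>c - 1 / K\<close> of the expansion
      \<open>c\<close>, which leaves exactly \<open>1 / K\<close>.\<close>
    have "c - 1 / K > 0" using K c_pos Kpos by (simp add: field_simps)
    then obtain d where d: "d > 0" "\<And>u. norm (u - x) < d \<Longrightarrow>
        norm (F u - F x - D (u - x)) \<le> (c - 1 / K) * norm (u - x)"
      using D(1) unfolding has_derivative_at_alt by blast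
    have exp: "norm (u - x) \<le> K * norm (F u - F x)" if "norm (u - x) < d" for u
    proof -
      have "c * norm (u - x) \<le> norm (D (u - x))"
        using lmin_le[OF has_derivative_bounded_linear[OF D(1)], of "u - x"] D(2)
        by (meson mult_right_mono norm_ge_zero order_trans)
      moreover have "norm (D (u - x)) \<le> norm (F u - F x) + norm (F u - F x - D (u - x))"
        using norm_triangle_sub[of "D (u - x)" "F u - F x"] by (simp add: norm_minus_commute)
      ultimately have "c * norm (u - x) \<le> norm (F u - F x) + (c - 1 / K) * norm (u - x)"
        using d(2)[OF that] by linarith
      then have "norm (u - x) / K \<le> norm (F u - F x)" by (simp add: algebra_simps)
      then show ?thesis using Kpos by (simp add: field_simps)
    qed
    show "\<exists>d>0. \<forall>u\<in>C. dist u y < d \<longrightarrow> dist (Finv u) (Finv y) \<le> K * dist u y"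
    \<comment> \<open>The crude constant \<open>L\<close> brings \<open>Finv u\<close> within
      \<open>d\<close> of \<open>x\<close>, where the expansion estimate is valid; the
      \<open>+ 1\<close> covers \<open>L = 0\<close>.\<close>
    proof (intro exI[of _ "d / (L + 1)"] conjI ballI impI)
      have L0: "L \<ge> 0" using lipschitz_on_nonneg[OF L] .
      then show "d / (L + 1) > 0" using d(1) by simp
      fix u assume u: "u \<in> C" "dist u y < d / (L + 1)"
      have "dist (Finv u) (Finv y) \<le> L * dist u y"
        using lipschitz_onD[OF L] u y C by blast
      also have "\<dots> \<le> (L + 1) * dist u y" by (simp add: mult_right_mono)
      also have "\<dots> < d" using u(2) L0 by (simp add: field_simps)
      finally have "norm (Finv u - x) < d" by (simp add: x_def dist_norm)
      from exp[OF this] show "dist (Finv u) (Finv y) \<le> K * dist u y"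
        using Finv_right_inverse(2)[of u] u(1) x(2) by (simp add: C_def x_def dist_norm)
    qed
  qed (use c_pos in simp)
  then show ?thesis
    using lipschitz_on_closure[of "1 / c" C Finv] cl lipschitz_on_continuous_on[OF L] by simp
qed

section \<open>Symmetries of F and inverse branches of the iterates of S\<close>

definition flip :: "real \<Rightarrow> real^'n \<Rightarrow> real^'n" where
  "flip e y = (\<chi> i. if i = k then e * y $ i else y $ i)"

text \<open>\<open>d\<close> tells which half-space \<open>A\<close> folds onto the upper one,
  \<open>e\<close> on which side the image lies before folding. Both signs multiply under
  composition.\<close>

definition symmetry :: "real \<Rightarrow> real \<Rightarrow> (real^'n \<Rightarrow> real^'n) \<Rightarrow> bool" where
  "symmetry d e A \<longleftrightarrow> (\<forall>u v. dist (A u) (A v) = dist u v) \<and> surj A \<and>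
     (\<forall>u. A u $ k = d * u $ k) \<and> (\<forall>u. F (A u) = flip e (F u))"

text \<open>The signs are listed target first: \<open>f\<close> leads from \<open>half e\<close>
  back into \<open>half s\<close>, so that composed branches chain as \<open>s e\<close>,
  \<open>e e'\<close>.\<close>

definition pullback :: "nat \<Rightarrow> real \<Rightarrow> real \<Rightarrow> real \<Rightarrow> (real^'n \<Rightarrow> real^'n) \<Rightarrow> bool" where
  "pullback n C s e f \<longleftrightarrow> (\<forall>y\<in>half e. f y \<in> half s \<and> (S ^^ n) (f y) = y) \<and> C-lipschitz_on (half e) f"

text \<open>Contraction factor of one branch: \<open>1 / c\<close> from \<open>Finv\<close> and
  \<open>1 / lam\<close> from the scaling in \<open>S\<close>.\<close>

definition rate :: real where "rate = 1 / (lam * c)"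

lemma rate: "0 < rate" "rate < 1 / 2"
  using expanding by (auto simp: rate_def field_simps)

lemma tau_eq_flip: "tau k = flip (-1)"
  by (auto simp: tau_def flip_def fun_eq_iff vec_eq_iff)

lemma flip_1 [simp]: "flip 1 y = y"
  by (simp add: flip_def vec_eq_iff)

lemma flip_flip [simp]: "flip d (flip e y) = flip (d * e) y"
  by (simp add: flip_def vec_eq_iff)

lemma flip_scaleR: "flip e (a *\<^sub>R y) = a *\<^sub>R flip e y"
  by (simp add: flip_def vec_eq_iff)

lemma flip_nth_k [simp]: "flip e y $ k = e * y $ k"
  by (simp add: flip_def)

lemma dist_flip: "e \<in> {1, -1} \<Longrightarrow> dist (flip e u) (flip e v) = dist u v"
proof -
  have "flip (-1) u - flip (-1) v = (\<chi> i. if i = k then - ((u - v) $ i) else (u - v) $ i)"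
    by (simp add: flip_def vec_eq_iff)
  then have "dist (flip (-1) u) (flip (-1) v) = dist u v"
    by (simp add: dist_norm norm_sign_change)
  then show "e \<in> {1, -1} \<Longrightarrow> dist (flip e u) (flip e v) = dist u v" by auto
qed

lemma symmetry_id: "symmetry 1 1 (\<lambda>x. x)"
  by (simp add: symmetry_def)

lemma symmetry_comp:
  assumes A: "symmetry d e A" and B: "symmetry d' e' B"
  shows "symmetry (d * d') (e * e') (\<lambda>x. A (B x))"
proof -
  have "surj (\<lambda>x. A (B x))"
    using comp_surj[of B A] A B by (simp add: symmetry_def comp_def)
  then show ?thesis using A B by (simp add: symmetry_def)
qed

lemma symmetry_crefl: "j \<noteq> k \<Longrightarrow> symmetry 1 (-1) (crefl j (2 * real_of_int m + 1))"
  by (simp add: symmetry_def dist_crefl surj_crefl F_crefl tau_eq_flip[symmetric])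
    (simp add: crefl_def)

lemma symmetry_crefl_k: "symmetry (-1) (-1) (crefl k 0)"
  by (simp add: symmetry_def dist_crefl surj_crefl F_crefl_k tau_eq_flip[symmetric])
    (simp add: crefl_def)

lemma fold_coordinate:
  assumes "j \<noteq> k"
  obtains e A where "e \<in> {1, -1}" "symmetry 1 e A" "\<bar>A x $ j\<bar> \<le> 1" "\<And>i. i \<noteq> j \<Longrightarrow> A x $ i = x $ i"
proof -
  \<comment> \<open>\<open>2 * n\<close> is an even integer nearest to the coordinate. For even
    \<open>n\<close> the shift by \<open>2 * n\<close> is a product of two wall reflections; for odd
    \<open>n\<close> the reflection in the wall at \<open>n\<close> suffices.\<close>
  define n where "n = round (x $ j / 2)"
  have n: "\<bar>x $ j - 2 * of_int n\<bar> \<le> 1"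
    using of_int_round_abs_le[of "x $ j / 2"] unfolding n_def by linarith
  show ?thesis
  proof (cases "even n")
    case True
    then obtain m where m: "n = 2 * m" by (elim evenE)
    have "symmetry 1 1 (\<lambda>x. crefl j 1 (crefl j (2 * real_of_int m + 1) x))"
      using symmetry_comp[OF symmetry_crefl[OF assms, of 0] symmetry_crefl[OF assms, of m]] by simp
    then show ?thesis by (rule that[rotated]) (use n m in \<open>auto simp: crefl_def\<close>)
  next
    case False
    then obtain m where m: "n = 2 * m + 1" by (elim oddE)
    show ?thesis
      by (rule that[OF _ symmetry_crefl[OF assms, of m]]) (use n m in \<open>auto simp: crefl_def\<close>)
  qed
qed

lemma fold_coordinates:
  assumes "finite J" "k \<notin> J"
  shows "\<exists>e\<in>{1, -1}. \<exists>A. symmetry 1 e A \<and> (\<forall>j\<in>J. \<bar>A x $ j\<bar> \<le> 1)"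
  using assms
proof (induction J)
  case empty
  then show ?case using symmetry_id by auto
next
  case (insert j J)
  then obtain e A where A: "e \<in> {1, -1}" "symmetry 1 e A" "\<forall>j\<in>J. \<bar>A x $ j\<bar> \<le> 1" by auto
  have "j \<noteq> k" using insert by auto
  then obtain e' B where B: "e' \<in> {1, -1}" "symmetry 1 e' B" "\<bar>B (A x) $ j\<bar> \<le> 1"
    "\<And>i. i \<noteq> j \<Longrightarrow> B (A x) $ i = A x $ i"
    using fold_coordinate[of j "A x"] by metis
  have "symmetry 1 (e' * e) (\<lambda>x. B (A x))" using symmetry_comp[OF B(2) A(2)] by simp
  moreover have "\<forall>i\<in>insert j J. \<bar>B (A x) $ i\<bar> \<le> 1" using A(3) B(3,4) insert.hyps by (metis insert_iff)
  moreover have "e' * e \<in> {1, -1}" using A(1) B(1) by auto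
  ultimately show ?case by blast
qed

lemma fold_into_beam:
  assumes "s \<in> {1, -1}" "x \<in> half s"
  obtains e A where "e \<in> {1, -1}" "symmetry s e A" "A x \<in> beam"
proof -
  obtain e0 B where B: "e0 \<in> {1, -1}" "symmetry s e0 B"
    using assms(1) symmetry_id symmetry_crefl_k by auto
  obtain e A where A: "e \<in> {1, -1}" "symmetry 1 e A" "\<forall>j\<in>- {k}. \<bar>A (B x) $ j\<bar> \<le> 1"
    using fold_coordinates[of "- {k}" "B x"] by auto
  have sym: "symmetry s (e * e0) (\<lambda>x. A (B x))" using symmetry_comp[OF A(2) B(2)] by simp
  then have "A (B x) $ k = s * x $ k" by (simp add: symmetry_def)
  then have "A (B x) \<in> beam" using A(3) assms(2) by (auto simp: beam_def half_def)
  then show ?thesis using that[OF _ sym] A(1) B(1) by auto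
qed

lemma S_0 [simp]: "S 0 = 0"
  by (simp add: S_def F_0)

text \<open>The branch is \<open>inv A\<close> after \<open>Finv\<close> after \<open>flip e\<close>
  after division by \<open>lam\<close>; the two isometries leave the contraction factor unchanged.
  The second conclusion makes it the branch through every point that \<open>A\<close> folds into the
  half-beam.\<close>

lemma symmetry_pullback:
  assumes A: "symmetry d e A" and e: "e \<in> {1, -1}"
  obtains f where "pullback 1 rate d e f" "\<And>x. A x \<in> beam \<Longrightarrow> S x \<in> half e \<and> f (S x) = x"
proof
  define g where "g y = flip e ((1 / lam) *\<^sub>R y)" for y
  define f where "f y = inv A (Finv (g y))" for y
  have iso: "dist (A u) (A v) = dist u v" for u v using A by (simp add: symmetry_def)
  have A_inv: "A (inv A u) = u" for u using A by (simp add: symmetry_def surj_f_inv_f)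
  have inv_A: "inv A (A u) = u" for u using iso[of "inv A (A u)" u] A_inv by simp
  have g_half: "g y \<in> half 1" if "y \<in> half e" for y
    using that lam by (simp add: g_def half_def)
  have dist_g: "dist (g y) (g z) = dist y z / lam" for y z
    using lam by (simp add: g_def dist_flip[OF e]) (simp add: dist_norm scaleR_diff_right[symmetric])
  have ee: "e * e = 1" using e by auto
  show "pullback 1 rate d e f"
    unfolding pullback_def
  proof (intro conjI ballI lipschitz_onI)
    fix y assume y: "y \<in> half e"
    have "g y $ k \<ge> 0" using g_half[OF y] by (simp add: half_def)
    note Fi = Finv_right_inverse[OF this]
    have Af: "A (f y) = Finv (g y)" by (simp add: f_def A_inv)
    have "A (f y) $ k \<ge> 0" using Fi(1) by (simp add: Af beam_def)
    then show "f y \<in> half d" using A by (simp add: half_def symmetry_def)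
    have "flip e (F (f y)) = g y" using A Fi(2) by (simp add: symmetry_def Af[symmetric])
    then have "flip e (flip e (F (f y))) = flip e (g y)" by simp
    then have "F (f y) = (1 / lam) *\<^sub>R y" by (simp add: g_def ee)
    then show "(S ^^ 1) (f y) = y" using lam by (simp add: S_def)
  next
    fix y z assume "y \<in> half e" "z \<in> half e"
    then have "dist (Finv (g y)) (Finv (g z)) \<le> 1 / c * (dist y z / lam)"
      using lipschitz_onD[OF Finv_contraction g_half g_half] by (simp add: dist_g)
    moreover have "dist (f y) (f z) = dist (Finv (g y)) (Finv (g z))"
      using iso[of "f y" "f z"] by (simp add: f_def A_inv)
    ultimately show "dist (f y) (f z) \<le> rate * dist y z" by (simp add: rate_def mult.commute)
  qed (use rate in simp)
  fix x assume x: "A x \<in> beam"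
  have FA: "F (A x) = flip e (F x)" using A by (simp add: symmetry_def)
  have "g (S x) = F (A x)" using lam by (simp add: g_def S_def FA)
  then have "f (S x) = x" by (simp add: f_def Finv_F[OF x] inv_A)
  moreover have "S x \<in> half e" 
    using mult_nonneg_nonneg[of lam "e * F x $ k"] F_beam_half[OF x] lam
    by (simp add: FA half_def S_def mult.left_commute[of e])
  ultimately show "S x \<in> half e \<and> f (S x) = x" by simp
qed

text \<open>Here the point dictates the sign \<open>e\<close>; \<open>pullback_any\<close>
  prescribes \<open>e\<close> but gives up control of the point.\<close>

lemma pullback_at:
  assumes "s \<in> {1, -1}" "x \<in> half s"
  obtains e f where "e \<in> {1, -1}" "pullback 1 rate s e f" "S x \<in> half e" "f (S x) = x"
proof -
  obtain e A where A: "e \<in> {1, -1}" "symmetry s e A" "A x \<in> beam" by (rule fold_into_beam[OF assms])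
  obtain f where "pullback 1 rate s e f" "\<And>x. A x \<in> beam \<Longrightarrow> S x \<in> half e \<and> f (S x) = x"
    using symmetry_pullback[OF A(2,1)] by blast
  then show ?thesis using that A(1,3) by blast
qed

text \<open>The identity or the reflection in the hyperplane serves as folding map. Both fix 0, and
  for both the two signs agree.\<close>

lemma pullback_fixing_0:
  assumes "s \<in> {1, -1}"
  obtains f where "pullback 1 rate s s f" "f 0 = 0"
proof -
  obtain A where "symmetry s s A" "A 0 = 0"
  proof (cases "s = 1")
    case True
    then show ?thesis using that symmetry_id by auto
  next
    case False
    moreover have "crefl k 0 0 = (0 :: real^'n)" by (simp add: crefl_def vec_eq_iff)
    ultimately show ?thesis using that symmetry_crefl_k assms by auto
  qed
  moreover have "(0 :: real^'n) \<in> beam" by (simp add: beam_def)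
  ultimately show ?thesis using symmetry_pullback[OF _ assms, of s A] that by (metis S_0)
qed

lemma lateral_index: obtains j where "j \<noteq> k"
proof -
  have "UNIV \<noteq> {k}"
  proof
    assume "UNIV = {k}"
    from arg_cong[OF this, of card] show False using card by simp
  qed
  then show ?thesis using that by blast
qed

text \<open>An extra reflection in a lateral wall reverses the image side but preserves
  \<open>half s\<close>. Such a wall exists because the dimension is at least 2.\<close>

lemma pullback_any:
  assumes s: "s \<in> {1, -1}" and e: "e \<in> {1, -1}"
  obtains f where "pullback 1 rate s e f"
proof -
  obtain j where j: "j \<noteq> k" by (rule lateral_index)
  obtain d A where A: "d \<in> {1, -1}" "symmetry s d A"
    using s symmetry_id symmetry_crefl_k by auto
  obtain A' where "symmetry s e A'"
  proof (cases "d = e")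
    case True
    then show ?thesis using that A by auto
  next
    case False
    then have "e = - d" using e A(1) by auto
    then show ?thesis using that symmetry_comp[OF symmetry_crefl[OF j, of 0] A(2)] by auto
  qed
  then show ?thesis using symmetry_pullback[OF _ e] that by blast
qed

lemma pullback_id: "pullback 0 1 s s (\<lambda>x. x)"
  by (auto simp: pullback_def intro!: lipschitz_onI)

lemma pullback_comp:
  assumes f: "pullback m C s e f" and g: "pullback n D e e' g"
  shows "pullback (m + n) (C * D) s e' (\<lambda>y. f (g y))"
proof -
  have "(S ^^ (m + n)) (f (g y)) = y" "f (g y) \<in> half s" if "y \<in> half e'" for y
    using f g that by (simp_all add: pullback_def add.commute[of m] funpow_add)
  moreover have "g ` half e' \<subseteq> half e" using g by (auto simp: pullback_def)
  then have "(C * D)-lipschitz_on (half e') (\<lambda>y. f (g y))"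
    using lipschitz_on_compose2[of D "half e'" g C f] f g
    by (auto simp: pullback_def intro: lipschitz_on_subset)
  ultimately show ?thesis by (simp add: pullback_def)
qed

lemma pullback_funpow:
  assumes "pullback 1 C s s f"
  shows "pullback N (C ^ N) s s (f ^^ N)"
proof (induction N)
  case 0
  then show ?case using pullback_id by (simp add: id_def)
next
  case (Suc N)
  then show ?case using pullback_comp[OF assms Suc] by (simp add: comp_def)
qed

text \<open>Contraction of the branch read forwards: points of \<open>half e\<close> within
  \<open>r / rate\<close> of \<open>p\<close> are pulled back to within \<open>r\<close> of
  \<open>f p\<close>.\<close>

lemma pullback_ball:
  assumes f: "pullback 1 rate s e f" and p: "p \<in> half e"
  shows "ball p (r / rate) \<inter> half e \<subseteq> S ` (ball (f p) r \<inter> half s)"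
proof
  fix y assume y: "y \<in> ball p (r / rate) \<inter> half e"
  have "dist (f p) (f y) \<le> rate * dist p y"
    using f p y by (auto simp: pullback_def intro: lipschitz_onD)
  also have "\<dots> < r" using y rate by (simp add: field_simps)
  finally have "f y \<in> ball (f p) r \<inter> half s" using f y by (auto simp: pullback_def)
  moreover have "S (f y) = y" using f y by (simp add: pullback_def)
  ultimately show "y \<in> S ` (ball (f p) r \<inter> half s)" by (metis imageI)
qed

section \<open>Blowing up\<close>

lemma in_half: obtains s where "s \<in> {1, -1}" "x \<in> half s"
proof (cases "x $ k \<ge> 0")
  case True
  then show ?thesis using that[of 1] by (simp add: half_def)
next
  case False
  then show ?thesis using that[of "-1"] by (simp add: half_def)
qed

lemma le_div_rate: "r \<ge> 0 \<Longrightarrow> r \<le> r / rate"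
  using rate mult_left_le[of rate r] by (simp add: le_divide_eq)

lemma ball_growth:
  assumes r: "r > 0"
  shows "\<exists>z. ball z (r / (2 * rate)) \<subseteq> S ` ball x r"
proof -
  obtain s where s: "s \<in> {1, -1}" "x \<in> half s" by (rule in_half)
  obtain e f where e: "e \<in> {1, -1}" and f: "pullback 1 rate s e f" "S x \<in> half e" "f (S x) = x"
    by (rule pullback_at[OF s])
  define R where "R = r / (2 * rate)"
  \<comment> \<open>Pushing the centre a distance \<open>R\<close> into \<open>half e\<close> fits a
    full ball of radius \<open>R\<close> into the half-ball of radius \<open>2 * R\<close>.\<close>
  define z where "z = S x + (e * R) *\<^sub>R axis k 1"
  have R: "R > 0" "r / rate = R + R" using r rate by (auto simp: R_def field_simps)
  have "ball z R \<subseteq> ball (S x) (r / rate) \<inter> half e"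
  proof
    fix u assume "u \<in> ball z R"
    then have u: "dist z u < R" by simp
    have "dist (S x) z = R" using e R by (auto simp: z_def dist_norm)
    then have "dist (S x) u < R + R" using u dist_triangle[of "S x" u z] by simp
    moreover have "\<bar>z $ k - u $ k\<bar> < R"
      using component_le_norm_cart[of "z - u" k] u by (simp add: dist_norm)
    then have "\<bar>e * z $ k - e * u $ k\<bar> < R" using e by auto
    moreover have "e * z $ k = e * S x $ k + R" using e by (auto simp: z_def)
    ultimately show "u \<in> ball (S x) (r / rate) \<inter> half e" using f(2) R by (auto simp: half_def)
  qed
  also have "\<dots> \<subseteq> S ` ball x r" using pullback_ball[OF f(1,2)] f(3) by fastforce
  finally show ?thesis unfolding R_def by blast
qed

lemma ball_growth_iterate:
  assumes "r > 0"
  shows "\<exists>z. ball z (r * (1 / (2 * rate)) ^ n) \<subseteq> (S ^^ n) ` ball x r"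
proof (induction n)
  case (Suc n)
  then obtain z where z: "ball z (r * (1 / (2 * rate)) ^ n) \<subseteq> (S ^^ n) ` ball x r" by blast
  have "r * (1 / (2 * rate)) ^ n > 0" using assms rate by simp
  from ball_growth[OF this, of z] obtain z' where
    "ball z' (r * (1 / (2 * rate)) ^ n / (2 * rate)) \<subseteq> S ` ball z (r * (1 / (2 * rate)) ^ n)" by blast
  also have "\<dots> \<subseteq> S ` (S ^^ n) ` ball x r" using z by (rule image_mono)
  finally show ?case by (intro exI[of _ z']) (simp add: image_comp field_simps)
qed auto

lemma large_ball:
  assumes "open U" "U \<noteq> {}"
  obtains n z where "ball z R \<subseteq> (S ^^ n) ` U"
proof -
  obtain x r where x: "r > 0" "ball x r \<subseteq> U" using assms by (meson equals0I openE)
  have "1 / (2 * rate) > 1" using rate by simp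
  then obtain n where n: "R / r < (1 / (2 * rate)) ^ n" using real_arch_pow by blast
  obtain z where "ball z (r * (1 / (2 * rate)) ^ n) \<subseteq> (S ^^ n) ` ball x r"
    using ball_growth_iterate[OF x(1)] by blast
  moreover have "ball z R \<subseteq> ball z (r * (1 / (2 * rate)) ^ n)"
    using n x(1) by (intro subset_ball) (simp add: field_simps)
  ultimately show ?thesis using that[of z n] x(2) by blast
qed

text \<open>A point of a lateral wall is fixed by the reflection in it, so its image is fixed by
  \<open>tau\<close> and has height 0. The walls sit at the odd integers, hence one is within
  distance 1.\<close>

lemma near_wall:
  obtains x where "dist z x \<le> 1" "S x $ k = 0"
proof -
  obtain j where j: "j \<noteq> k" by (rule lateral_index)
  define m where "m = round ((z $ j - 1) / 2)"
  define a where "a = 2 * real_of_int m + 1"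
  define x where "x = (\<chi> i. if i = j then a else z $ i)"
  have "crefl j a x = x" by (simp add: crefl_def x_def vec_eq_iff)
  then have "F x = tau k (F x)" using F_crefl[OF j, of m x] by (simp add: a_def)
  then have "F x $ k = tau k (F x) $ k" by simp
  then have "S x $ k = 0" by (simp add: tau_def S_def)
  moreover have "dist z x \<le> 1"
  proof -
    have "z - x = (z $ j - a) *\<^sub>R axis j 1" by (auto simp: x_def vec_eq_iff axis_def)
    then have "dist z x = \<bar>z $ j - a\<bar>" by (simp add: dist_norm)
    also have "\<dots> \<le> 1"
    proof -
      have "\<bar>of_int m - (z $ j - 1) / 2\<bar> \<le> 1 / 2" unfolding m_def by (rule of_int_round_abs_le)
      moreover have "z $ j - a = - 2 * (of_int m - (z $ j - 1) / 2)" by (simp add: a_def field_simps)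
      ultimately show ?thesis by (simp only: abs_mult) simp
    qed
    finally show ?thesis .
  qed
  ultimately show ?thesis using that by blast
qed

text \<open>Moving to a wall point costs 1 in radius and gains a centre of height 0, as
  \<open>norm_S_wall\<close> requires.\<close>

lemma half_ball_from_ball:
  assumes "R > 1"
  obtains p e where "p $ k = 0" "e \<in> {1, -1}" "ball p (R - 1) \<inter> half e \<subseteq> S ` ball z R"
proof -
  obtain x where x: "dist z x \<le> 1" "S x $ k = 0" by (rule near_wall)
  obtain s where s: "s \<in> {1, -1}" "x \<in> half s" by (rule in_half)
  obtain e f where e: "e \<in> {1, -1}" and f: "pullback 1 rate s e f" "S x \<in> half e" "f (S x) = x"
    by (rule pullback_at[OF s])
  have "ball (S x) (R - 1) \<subseteq> ball (S x) ((R - 1) / rate)"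
    using assms by (intro subset_ball le_div_rate) simp
  then have "ball (S x) (R - 1) \<inter> half e \<subseteq> S ` (ball x (R - 1) \<inter> half s)"
    using pullback_ball[OF f(1,2), of "R - 1"] f(3) by auto
  moreover have "ball x (R - 1) \<subseteq> ball z R"
    using x(1) by (auto simp: ball_def) (smt (verit) dist_triangle)
  ultimately show ?thesis using that[OF x(2) e] by blast
qed

text \<open>Folding takes \<open>p\<close> to the bottom face of the half-cube, which
  \<open>F\<close> maps into the unit ball. The bound is uniform in \<open>p\<close>, however far
  away it lies.\<close>

lemma norm_S_wall:
  assumes "p $ k = 0"
  shows "norm (S p) \<le> lam"
proof -
  have "p \<in> half 1" using assms by (simp add: half_def)
  then obtain e A where A: "e \<in> {1, -1}" "symmetry 1 e A" "A p \<in> beam"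
    using fold_into_beam[of 1 p] by auto
  have "A p $ k = 0" using A(2) assms by (simp add: symmetry_def)
  then have "A p \<in> halfcube k" using A(3) by (simp add: beam_def halfcube_def)
  then have "norm (F (A p)) \<le> 1" by (rule F_halfcube_bounds)
  moreover have "norm (F (A p)) = norm (F p)"
    using A(2) dist_flip[OF A(1), of "F p" 0] flip_scaleR[of e 0 0] by (simp add: symmetry_def)
  ultimately show ?thesis using lam by (simp add: S_def)
qed

text \<open>As \<open>p\<close> lies in both half-spaces, a branch through it exists whichever
  half-ball is given. The new centre \<open>S p\<close> is within \<open>lam\<close> of 0, and
  giving up \<open>lam\<close> in radius absorbs the shift.\<close>

lemma half_ball_recentre:
  assumes p: "p $ k = 0" and s: "s \<in> {1, -1}" and q: "q \<ge> 0"
  obtains e where "e \<in> {1, -1}" "ball 0 (q - lam) \<inter> half e \<subseteq> S ` (ball p q \<inter> half s)"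
proof -
  have ps: "p \<in> half s" using p by (simp add: half_def)
  obtain e f where e: "e \<in> {1, -1}" and f: "pullback 1 rate s e f" "S p \<in> half e" "f (S p) = p"
    by (rule pullback_at[OF s ps])
  have "ball 0 (q - lam) \<subseteq> ball (S p) (q / rate)"
    using norm_S_wall[OF p] le_div_rate[OF q] norm_triangle_ineq4
    by (auto simp: dist_norm) (smt (verit) norm_triangle_ineq4)
  then show ?thesis using pullback_ball[OF f(1,2), of q] f(3) that[OF e] by auto
qed

text \<open>Each half of the target ball has its own branch into \<open>half s\<close>. Only four
  branches are involved, so a single \<open>K\<close>, independent of \<open>r\<close>, bounds their
  values at 0.\<close>

lemma ball_from_half_ball:
  "\<exists>K. \<forall>s\<in>{1, -1}. \<forall>r\<ge>K. ball 0 (r - K) \<subseteq> S ` (ball 0 r \<inter> half s)"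
proof -
  have "\<exists>f. pullback 1 rate s e f" if "s \<in> {1, -1}" "e \<in> {1, -1}" for s e
    using pullback_any[OF that] by blast
  then obtain f where f: "\<And>s e. s \<in> {1, -1} \<Longrightarrow> e \<in> {1, -1} \<Longrightarrow> pullback 1 rate s e (f s e)"
    by metis
  define K where "K = norm (f 1 1 0) + norm (f 1 (-1) 0) + norm (f (-1) 1 0) + norm (f (-1) (-1) 0)"
  have K: "norm (f s e 0) \<le> K" if "s \<in> {1, -1}" "e \<in> {1, -1}" for s e
    using that by (auto simp: K_def)
  show ?thesis
  proof (intro exI[of _ K] ballI allI impI subsetI)
    fix s r :: real and y assume s: "s \<in> {1, -1}" and r: "r \<ge> K" and y: "y \<in> ball (0 :: real^'n) (r - K)"
    obtain e where e: "e \<in> {1, -1}" "y \<in> half e" by (rule in_half)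
    have "ball 0 ((r - K) / rate) \<inter> half e \<subseteq> S ` (ball (f s e 0) (r - K) \<inter> half s)"
      by (rule pullback_ball[OF f[OF s e(1)]]) (simp add: half_def)
    moreover have "y \<in> ball 0 ((r - K) / rate)" using y r le_div_rate[of "r - K"] by auto
    moreover have "ball (f s e 0) (r - K) \<subseteq> ball 0 r"
    proof
      fix u assume "u \<in> ball (f s e 0) (r - K)"
      then have "dist 0 (f s e 0) + dist (f s e 0) u < r" using K[OF s e(1)] by simp
      then show "u \<in> ball 0 r" using dist_triangle[of 0 u "f s e 0"] by simp
    qed
    ultimately show "y \<in> S ` (ball 0 r \<inter> half s)" using e(2) by blast
  qed
qed

lemma blowing_up:
  assumes "open U" "U \<noteq> {}"
  shows "(\<Union>n. (S ^^ n) ` U) = UNIV"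
proof -
  have "\<exists>n. y \<in> (S ^^ n) ` U" for y
  proof -
    obtain K where K: "\<forall>s\<in>{1, -1}. \<forall>r\<ge>K. ball 0 (r - K) \<subseteq> S ` (ball 0 r \<inter> half s)"
      using ball_from_half_ball by blast
    \<comment> \<open>The radius loses 1 at the wall, \<open>lam\<close> in recentring and
      \<open>K\<close> in joining the halves; at least \<open>norm y + 1\<close> is left.\<close>
    define R where "R = norm y + 2 + lam + \<bar>K\<bar>"
    have R: "R > 1" "R - 1 \<ge> 0" "R - 1 - lam \<ge> K" "norm y < R - 1 - lam - K"
      using lam norm_ge_zero[of y] abs_ge_self[of K] abs_ge_zero[of K] unfolding R_def by linarith+
    obtain n z where 1: "ball z R \<subseteq> (S ^^ n) ` U" using large_ball[OF assms] by blast
    obtain p s where p: "p $ k = 0" "s \<in> {1, -1}" "ball p (R - 1) \<inter> half s \<subseteq> S ` ball z R"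
      by (rule half_ball_from_ball[OF R(1)])
    obtain e where e: "e \<in> {1, -1}" "ball 0 (R - 1 - lam) \<inter> half e \<subseteq> S ` (ball p (R - 1) \<inter> half s)"
      by (rule half_ball_recentre[OF p(1,2) R(2)])
    have "y \<in> ball 0 (R - 1 - lam - K)" using R(4) by simp
    also have "\<dots> \<subseteq> S ` (ball 0 (R - 1 - lam) \<inter> half e)" using K e(1) R(3) by blast
    also have "\<dots> \<subseteq> S ` S ` (ball p (R - 1) \<inter> half s)" using e(2) by (rule image_mono)
    also have "\<dots> \<subseteq> S ` S ` S ` ball z R" using p(3) by (intro image_mono)
    also have "\<dots> \<subseteq> S ` S ` S ` (S ^^ n) ` U" using 1 by (intro image_mono)
    also have "\<dots> = (S ^^ Suc (Suc (Suc n))) ` U" by (simp add: image_comp comp_assoc)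
    finally show ?thesis by blast
  qed
  then show ?thesis by blast
qed

section \<open>Periodic points\<close>

text \<open>The constant is relaxed to 1, which also covers \<open>m = 0\<close>; the contraction
  needed later comes from the branch fixing 0.\<close>

lemma pullback_along_orbit:
  assumes "s \<in> {1, -1}" "x \<in> half s" "(S ^^ m) x = 0"
  shows "\<exists>e\<in>{1, -1}. \<exists>f. pullback m 1 s e f \<and> f 0 = x"
  using assms
proof (induction m arbitrary: x s)
  case 0
  then show ?case using pullback_id[of s] by auto
next
  case (Suc m)
  obtain e f where e: "e \<in> {1, -1}" and f: "pullback 1 rate s e f" "S x \<in> half e" "f (S x) = x"
    by (rule pullback_at[OF Suc.prems(1,2)])
  have "(S ^^ m) (S x) = 0" using Suc.prems(3) by (simp add: funpow_swap1)
  from Suc.IH[OF e f(2) this] obtain e' g where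
    g: "e' \<in> {1, -1}" "pullback m 1 e e' g" "g 0 = S x" by blast
  have "pullback (Suc m) (rate * 1) s e' (\<lambda>y. f (g y))" using pullback_comp[OF f(1) g(2)] by simp
  then have "pullback (Suc m) 1 s e' (\<lambda>y. f (g y))"
    using rate by (auto simp: pullback_def intro: lipschitz_on_le)
  then show ?case using g(1,3) f(3) by auto
qed

lemma periodic_point_near:
  assumes m: "(S ^^ m) x = 0" and \<epsilon>: "\<epsilon> > 0"
  obtains n p where "n > 0" "(S ^^ n) p = p" "dist p x < \<epsilon>"
proof -
  obtain s where s: "s \<in> {1, -1}" "x \<in> half s" by (rule in_half)
  obtain e f where e: "e \<in> {1, -1}" and f: "pullback m 1 s e f" "f 0 = x"
    using pullback_along_orbit[OF s m] by blast
  obtain g where g: "pullback 1 rate e e g" "g 0 = 0" by (rule pullback_fixing_0[OF e])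
  obtain h where h: "pullback 1 rate e s h" by (rule pullback_any[OF e s(1)])
  \<comment> \<open>In the final estimate the term \<open>\<theta> * dist p x\<close> is absorbed
    into the left side, which produces the factor 2; the \<open>+ 1\<close> makes \<open>b\<close>
    positive.\<close>
  define b where "b = 2 * (norm (h x) + 1)"
  have b: "b > 0" by (simp add: b_def add_nonneg_pos)
  obtain N where N: "rate ^ N < min (1 / 2) (\<epsilon> / b)"
    using real_arch_pow_inv[of "min (1 / 2) (\<epsilon> / b)" rate] rate \<epsilon> b by auto
  define \<theta> where "\<theta> = rate ^ N"
  have \<theta>: "0 < \<theta>" "\<theta> < 1 / 2" "\<theta> * b < \<epsilon>" using N rate b by (auto simp: \<theta>_def field_simps)
  have gN: "pullback N \<theta> e e (g ^^ N)" unfolding \<theta>_def by (rule pullback_funpow[OF g(1)])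
  have gN0: "(g ^^ N) 0 = 0" by (induction N) (auto simp: g(2))
  have fg: "pullback (m + N) \<theta> s e (\<lambda>y. f ((g ^^ N) y))" using pullback_comp[OF f(1) gN] by simp
  \<comment> \<open>\<open>h\<close> leads from \<open>half s\<close> into \<open>half e\<close>,
    the powers of \<open>g\<close> contract towards 0, and \<open>f\<close> carries 0 to
    \<open>x\<close>. The step of \<open>h\<close> makes the period positive even when
    \<open>m\<close> and \<open>N\<close> are 0.\<close>
  define T where "T y = f ((g ^^ N) (h y))" for y
  have T: "pullback (m + N + 1) (\<theta> * rate) s s T"
    using pullback_comp[OF fg h] by (simp add: T_def[abs_def])
  have closed: "closed (half s)"
    unfolding half_def by (intro closed_Collect_le continuous_intros)
  have "\<exists>!p. p \<in> half s \<and> T p = p"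
  proof (rule Banach_fix)
    show "complete (half s)" using closed by (simp add: complete_eq_closed)
    show "half s \<noteq> {}" using s(2) by blast
    show "0 \<le> \<theta> * rate" using \<theta> rate by simp
    show "\<theta> * rate < 1" using \<theta> rate mult_strict_mono[of \<theta> 1 rate 1] by simp
    show "T ` half s \<subseteq> half s" using T by (auto simp: pullback_def)
    show "\<And>u v. u \<in> half s \<Longrightarrow> v \<in> half s \<Longrightarrow> dist (T u) (T v) \<le> \<theta> * rate * dist u v"
      using T by (auto simp: pullback_def intro: lipschitz_onD)
  qed
  then obtain p where p: "p \<in> half s" "T p = p" by blast
  have per: "(S ^^ (m + N + 1)) p = p"
  proof -
    have "(S ^^ (m + N + 1)) (T p) = p" using T p(1) unfolding pullback_def by blast
    then show ?thesis by (simp only: p(2))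
  qed
  have "dist p x = dist (f ((g ^^ N) (h p))) (f ((g ^^ N) 0))"
    using p(2) gN0 f(2) by (simp add: T_def)
  also have "\<dots> \<le> \<theta> * dist (h p) 0"
    using fg h p(1) by (intro lipschitz_onD[where X = "half e"]) (auto simp: pullback_def half_def)
  also have "dist (h p) 0 \<le> norm (h x) + dist p x"
  proof -
    have "dist (h p) (h x) \<le> rate * dist p x"
      using h p(1) s(2) by (intro lipschitz_onD[where X = "half s"]) (auto simp: pullback_def)
    also have "\<dots> \<le> 1 * dist p x" using rate by (intro mult_right_mono) auto
    finally show ?thesis using norm_triangle_sub[of "h p" "h x"] by (simp add: dist_norm)
  qed
  finally have "dist p x \<le> \<theta> * norm (h x) + \<theta> * dist p x"
    using \<theta>(1) by (simp add: distrib_left)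
  moreover have "\<theta> * dist p x \<le> 1 / 2 * dist p x" using \<theta>(2) by (intro mult_right_mono) auto
  ultimately have "dist p x \<le> \<theta> * (2 * norm (h x))" by simp
  also have "\<dots> \<le> \<theta> * b" using \<theta>(1) by (simp add: b_def)
  finally show ?thesis using that[OF _ per] \<theta>(3) by simp
qed

lemma hits_point:
  assumes "open U" "U \<noteq> {}"
  obtains n u where "u \<in> U" "(S ^^ n) u = y"
proof -
  have "y \<in> (\<Union>n. (S ^^ n) ` U)" by (simp only: blowing_up[OF assms] UNIV_I)
  then show ?thesis using that by blast
qed

lemma backward_orbit_dense: "closure (\<Union>n. (S ^^ n) -` {y}) = UNIV"
  by (rule dense_if_meets_open) (auto elim!: hits_point)

lemma periodic_points_dense: "closure {x. \<exists>n>0. (S ^^ n) x = x} = UNIV"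
proof (rule dense_if_meets_open)
  fix U :: "(real^'n) set" assume U: "open U" "U \<noteq> {}"
  then obtain m x where x: "x \<in> U" "(S ^^ m) x = 0" by (rule hits_point)
  obtain r where r: "r > 0" "ball x r \<subseteq> U" using U x openE by blast
  obtain n p where "n > 0" "(S ^^ n) p = p" "dist p x < r" by (rule periodic_point_near[OF x(2) r(1)])
  then show "\<exists>x\<in>U. x \<in> {x. \<exists>n>0. (S ^^ n) x = x}"
    using r(2) by (auto simp: dist_commute intro!: bexI[of _ p])
qed

end

text \<open>The essential infimum of the dilatation is expressed through its almost everywhere lower
  bounds \<open>c\<close>: the condition on \<open>lam\<close> asks that one of them be large
  enough.\<close>

theorem theorem1p1:
  fixes k :: "'n::finite" and F :: "real^'n \<Rightarrow> real^'n" and lam :: real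
  assumes "CARD('n) \<ge> 2"
    and "construction_F k F"
    and "lam > 0"
    and "\<exists>c. lam * c > 4 * sqrt (real CARD('n) - 1) \<and>
           (AE x in lebesgue. \<exists>D. (F has_derivative D) (at x) \<and> lmin D \<ge> c)"
  shows "closure {x. \<exists>n>0. ((\<lambda>y. lam *\<^sub>R F y) ^^ n) x = x} = UNIV
     \<and> (\<forall>U. open U \<and> U \<noteq> {} \<longrightarrow> (\<Union>n. ((\<lambda>y. lam *\<^sub>R F y) ^^ n) ` U) = UNIV)
     \<and> (\<forall>x. closure (\<Union>n. ((\<lambda>y. lam *\<^sub>R F y) ^^ n) -` {x}) = UNIV)"
proof -
  obtain c where c: "lam * c > 4 * sqrt (real CARD('n) - 1)"
    "AE x in lebesgue. \<exists>D. (F has_derivative D) (at x) \<and> lmin D \<ge> c"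
    using assms(4) by blast
  have "sqrt (real CARD('n) - 1) \<ge> 1" using assms(1) by simp
  then have "lam * c > 2" using c(1) by linarith
  then interpret quasiregular_sine k F lam c
    using assms(1-3) c(2) by unfold_locales
  have S: "(\<lambda>y. lam *\<^sub>R F y) = S" by (simp add: S_def[abs_def])
  show ?thesis
    unfolding S using periodic_points_dense blowing_up backward_orbit_dense by blast
qed

end
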